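(* Let $1\le m\le n$, let $A\in\mathbb{R}^{n\times n}$ be invertible, let $W,V\in\mathbb{R}^{n\times m}$ be full-rank matrices with $\det(W^{T}AV)\neq 0$, and let $b,x_0\in\mathbb{R}^n$. Let $Y$ be a real matrix with $n$ rows such that $\mathrm{Range}(Y)=\mathrm{Null}(W^{T}A)$, let $G\ge 0$ be a symmetric positive semidefinite matrix of conformable size, and set $\Sigma_0=VV^{T}+YGY^{T}$. Let $x$ be a random vector with distribution $\mathcal{N}(x_0,\Sigma_0)$ and let $y=W^{T}Ax$. Then the conditional distribution of $x$ given $y=W^{T}b$ is $\mathcal{N}(\widetilde{x},\,YGY^{T})$, where $$\widetilde{x}=x_0+V\left(W^{T}AV\right)^{-1}W^{T}\left(b-Ax_0\right).$$
   Context: For $\mu\in\mathbb{R}^n$ and a symmetric positive semidefinite matrix $\Sigma$ (possibly singular), $\mathcal{N}(\mu,\Sigma)$ denotes the (possibly degenerate) Gaussian distribution with mean $\mu$ and covariance $\Sigma$, supported on $\mu+\mathrm{Range}(\Sigma)$. $V$, $W$, $Y$, $G$, $x_0$, $b$ are deterministic. Conditioning on $y=W^Tb$ is the usual conditioning of jointly Gaussian vectors (the covariance $W^TA\Sigma_0A^TW$ of $y$ is invertible). *)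

theory Defs
  imports "HOL-Probability.Probability"
begin

definition pos_semidef :: "real^'n^'n \<Rightarrow> bool" where
  "pos_semidef S \<longleftrightarrow> transpose S = S \<and> (\<forall>v. 0 \<le> v \<bullet> (S *v v))"

text \<open>The univariate normal law with mean \<open>m\<close> and variance \<open>v\<close>; for \<open>v = 0\<close> it is the
  point mass at \<open>m\<close>. Note that \<^const>\<open>normal_density\<close> takes the standard deviation.\<close>

definition normal_law :: "real \<Rightarrow> real \<Rightarrow> real measure" where
  "normal_law m v =
     (if v = 0 then return borel m else density lborel (normal_density m (sqrt v)))"

text \<open>\<open>gaussian_law \<mu> S N\<close> says that \<open>N\<close> is the (possibly degenerate) Gaussian law with mean
  \<open>\<mu>\<close> and covariance \<open>S\<close>: every linear functional has the univariate normal law with the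
  corresponding mean and variance. By the Cramer-Wold theorem this determines \<open>N\<close>. No density is
  used, so \<open>S\<close> may be singular; \<open>N\<close> is then carried by \<open>\<mu> + range ((*v) S)\<close>.\<close>

definition gaussian_law :: "real^'n \<Rightarrow> real^'n^'n \<Rightarrow> (real^'n) measure \<Rightarrow> bool" where
  "gaussian_law \<mu> S N \<longleftrightarrow>
     pos_semidef S \<and> sets N = sets borel \<and>
     (\<forall>t. distr N borel (\<lambda>u. t \<bullet> u) = normal_law (t \<bullet> \<mu>) (t \<bullet> (S *v t)))"

text \<open>\<open>K\<close> is a regular conditional distribution of \<open>X\<close> given \<open>Y\<close>: a Markov kernel that
  disintegrates the joint law of \<open>Y\<close> and \<open>X\<close>.\<close>

definition regular_cond_dist ::
  "'w measure \<Rightarrow> ('w \<Rightarrow> 'x::topological_space) \<Rightarrow> ('w \<Rightarrow> 'y::topological_space) \<Rightarrow>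
   ('y \<Rightarrow> 'x measure) \<Rightarrow> bool" where
  "regular_cond_dist M X Y K \<longleftrightarrow>
     K \<in> borel \<rightarrow>\<^sub>M prob_algebra borel \<and>
     (\<forall>B\<in>sets borel. \<forall>C\<in>sets borel.
        emeasure M {\<omega> \<in> space M. Y \<omega> \<in> B \<and> X \<omega> \<in> C} =
        (\<integral>\<^sup>+ z \<in> B. emeasure (K z) C \<partial>distr M borel Y))"

definition weakly_continuous_kernel ::
  "('y::topological_space \<Rightarrow> 'x::topological_space measure) \<Rightarrow> bool" where
  "weakly_continuous_kernel K \<longleftrightarrow>
     (\<forall>f :: 'x \<Rightarrow> real. continuous_on UNIV f \<longrightarrow> bounded (range f) \<longrightarrow>
        continuous_on UNIV (\<lambda>z. \<integral>u. f u \<partial>K z))"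

text \<open>\<open>N\<close> is the conditional distribution of \<open>X\<close> given \<open>Y = z\<close>. The event \<open>Y = z\<close> may be
  null, and a regular conditional distribution is only determined almost everywhere with respect
  to the law of \<open>Y\<close>. As usual for jointly Gaussian vectors, its value at a point is that of the
  weakly continuous version. Both the existence of that version and the independence of its value
  at \<open>z\<close> from the choice of version are part of the definition.\<close>

definition cond_dist_at ::
  "'w measure \<Rightarrow> ('w \<Rightarrow> 'x::topological_space) \<Rightarrow> ('w \<Rightarrow> 'y::topological_space) \<Rightarrow>
   'y \<Rightarrow> 'x measure \<Rightarrow> bool" where
  "cond_dist_at M X Y z N \<longleftrightarrow>
     (\<exists>K. regular_cond_dist M X Y K \<and> weakly_continuous_kernel K \<and> K z = N) \<and>
     (\<forall>K. regular_cond_dist M X Y K \<and> weakly_continuous_kernel K \<longrightarrow> K z = N)"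

end

theory Submission
  imports Defs
begin

text \<open>Put \<open>H = W\<^sup>T A\<close>, \<open>R = V (H V)\<^sup>-\<^sup>1\<close> and \<open>D = I - R H\<close>, so that \<open>H R = I\<close>, \<open>D V = 0\<close> and
  \<open>D Y = Y\<close>. Then \<open>x = R y + D x\<close>, where \<open>R y\<close> and \<open>D x\<close> have covariances \<open>V V\<^sup>T\<close> and
  \<open>Y G Y\<^sup>T\<close>, which add up to that of \<open>x\<close>. Hence for independent copies \<open>u, v\<close> of \<open>x\<close> the vector
  \<open>R H u + D v\<close> has the characteristic function, and so the law, of \<open>x\<close>, while \<open>H\<close> maps it to
  \<open>H u\<close>. So the law of \<open>R z + D v\<close> is a version of the conditional law of \<open>x\<close> given
  \<open>y = z\<close>; it is Gaussian and weakly continuous in \<open>z\<close>. Two weakly continuous versions agree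
  almost everywhere for the law of \<open>y\<close>, which charges every nonempty open set because its
  covariance \<open>(H V) (H V)\<^sup>T\<close> is invertible, so by continuity they agree everywhere.\<close>

section \<open>Uniqueness of multivariate characteristic functions\<close>

text \<open>Reweighting by \<open>w / c\<close>, where \<open>c\<close> is the common total mass,
  turns both images under \<open>X\<close> into probability laws on the line with equal
  characteristic functions, so Levy's uniqueness theorem applies.\<close>

lemma weighted_char_unique:
  fixes w X :: "'a \<Rightarrow> real"
  assumes fin: "finite_measure M" "finite_measure N" and sets: "sets N = sets M"
    and w [measurable]: "w \<in> borel_measurable M" and X [measurable]: "X \<in> borel_measurable M"
    and w0: "\<And>u. 0 \<le> w u" and wK: "\<And>u. w u \<le> K"
    and eq: "\<And>s. (CLINT u|M. w u *\<^sub>R iexp (s * X u)) = (CLINT u|N. w u *\<^sub>R iexp (s * X u))"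
    and B [measurable]: "B \<in> sets borel"
  shows "(LINT u|M. w u * indicator B (X u)) = (LINT u|N. w u * indicator B (X u))"
proof -
  have measN [measurable]: "w \<in> borel_measurable N" "X \<in> borel_measurable N"
    using w X by (simp_all cong: measurable_cong_sets add: sets)
  have int: "integrable M w" "integrable N w"
    using fin w0 wK by (auto intro!: finite_measure.integrable_const_bound[where B = K])
  define c where "c = (LINT u|M. w u)"
  \<comment> \<open>At \<open>s = 0\<close> the hypothesis compares the total masses, so one
    constant \<open>c\<close> normalises both sides.\<close>
  have "complex_of_real c = complex_of_real (LINT u|N. w u)"
    using eq[of 0] by (simp add: c_def scaleR_conv_of_real)
  then have cN: "c = (LINT u|N. w u)" by (simp only: of_real_eq_iff)
  have c0: "0 \<le> c" unfolding c_def using w0 by simp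
  show ?thesis
  proof (cases "c = 0")
    \<comment> \<open>No normalisation is possible for \<open>c = 0\<close>, but then the
      nonnegative weight vanishes almost everywhere for both measures.\<close>
    case True
    have "AE u in M. w u = 0" "AE u in N. w u = 0"
      using integral_nonneg_eq_0_iff_AE[OF int(1)] integral_nonneg_eq_0_iff_AE[OF int(2)] w0 True cN
      by (simp_all add: c_def)
    then have "(LINT u|M. w u * indicator B (X u)) = 0" "(LINT u|N. w u * indicator B (X u)) = 0"
      by (auto intro!: integral_eq_zero_AE)
    then show ?thesis by simp
  next
    case False
    then have c: "0 < c" using c0 by simp
    define D where "D Q = distr (density Q (\<lambda>u. ennreal (w u / c))) borel X" for Q
    have D: "real_distribution (D Q) \<and> (\<forall>s. char (D Q) s = (CLINT u|Q. w u *\<^sub>R iexp (s * X u)) / c)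
        \<and> measure (D Q) B = (LINT u|Q. w u * indicator B (X u)) / c"
      if Q: "finite_measure Q" "c = (LINT u|Q. w u)" "integrable Q w"
        and [measurable]: "w \<in> borel_measurable Q" "X \<in> borel_measurable Q" for Q
    proof -
      have "emeasure (density Q (\<lambda>u. ennreal (w u / c))) (space Q) = (\<integral>\<^sup>+u. ennreal (w u / c) \<partial>Q)"
        by (simp add: emeasure_density cong: nn_integral_cong)
      also have "\<dots> = ennreal (LINT u|Q. w u / c)"
        using w0 c Q by (intro nn_integral_eq_integral) auto
      also have "\<dots> = 1" using Q c by simp
      finally have p: "prob_space (density Q (\<lambda>u. ennreal (w u / c)))"
        by (intro prob_spaceI) simp
      then have r: "real_distribution (D Q)"
        unfolding D_def by (intro prob_space.real_distribution_distr) auto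
      have ch: "char (D Q) s = (CLINT u|Q. w u *\<^sub>R iexp (s * X u)) / c" for s
      proof -
        have "char (D Q) s = (CLINT u|Q. (w u / c) *\<^sub>R iexp (s * X u))"
          unfolding char_def D_def using w0 c by (simp add: integral_distr integral_density)
        also have "\<dots> = (CLINT u|Q. (w u *\<^sub>R iexp (s * X u)) / c)"
          by (intro Bochner_Integration.integral_cong) (auto simp: scaleR_conv_of_real)
        finally show ?thesis by simp
      qed
      have "measure (D Q) B = (LINT u|D Q. indicator B u)"
        by (simp add: D_def)
      also have "\<dots> = (LINT u|density Q (\<lambda>u. ennreal (w u / c)). indicator B (X u))"
        unfolding D_def by (intro integral_distr) auto
      also have "\<dots> = (LINT u|Q. w u * indicator B (X u) / c)"
        using w0 c by (subst integral_density) auto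
      finally show ?thesis using r ch by simp
    qed
    have "D M = D N"
      using D[of M] D[of N] fin int c_def cN eq by (intro Levy_uniqueness) auto
    then show ?thesis using D[of M] D[of N] fin int c_def cN c by auto
  qed
qed

text \<open>The indicators are inserted one coordinate at a time. One-dimensional uniqueness needs
  nonnegative weights, so the remaining exponential enters through the weights
  \<open>1 + Re (c * iexp (t \<bullet> u))\<close> with \<open>c = 0, 1, \<i>\<close>.\<close>

lemma char_determines_coordinates:
  fixes M N :: "'a::euclidean_space measure"
  assumes M: "prob_space M" "sets M = sets borel" and N: "prob_space N" "sets N = sets borel"
    and eq: "\<And>t. (CLINT u|M. iexp (t \<bullet> u)) = (CLINT u|N. iexp (t \<bullet> u))"
    and B: "\<And>j. B j \<in> sets borel" and J: "finite J"
  shows "(CLINT u|M. (\<Prod>j\<in>J. indicator (B j) (u \<bullet> j)) *\<^sub>R iexp (t \<bullet> u)) =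
         (CLINT u|N. (\<Prod>j\<in>J. indicator (B j) (u \<bullet> j)) *\<^sub>R iexp (t \<bullet> u))"
  using J
proof (induction J arbitrary: t rule: finite_induct)
  case empty
  then show ?case using eq by simp
next
  case (insert j J)
  note B [measurable] M(2) [measurable_cong] N(2) [measurable_cong]
  \<comment> \<open>\<open>p\<close> collects the indicators inserted so far.\<close>
  define p :: "'a \<Rightarrow> real" where "p u = (\<Prod>j\<in>J. indicator (B j) (u \<bullet> j))" for u
  have p [measurable]: "p \<in> borel_measurable borel"
    unfolding p_def by measurable
  have p01: "0 \<le> p u" "p u \<le> 1" for u
    unfolding p_def by (auto intro!: prod_nonneg prod_le_1)
  have int: "integrable Q (\<lambda>u. p u *\<^sub>R iexp (r \<bullet> u))"
    if "prob_space Q" "sets Q = sets borel" for Q r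
  proof -
    note that(2) [measurable_cong]
    show ?thesis
      using p01 by (intro finite_measure.integrable_const_bound[where B = 1] prob_space.finite_measure that) auto
  qed
  have w: "(LINT u|M. (p u * (1 + Re (c * iexp (t \<bullet> u)))) * indicator (B j) (u \<bullet> j)) =
      (LINT u|N. (p u * (1 + Re (c * iexp (t \<bullet> u)))) * indicator (B j) (u \<bullet> j))"
    if c: "cmod c \<le> 1" for c
  proof (rule weighted_char_unique[where K = 2])
    show "finite_measure M" "finite_measure N" "sets N = sets M"
      using M N by (auto intro: prob_space.finite_measure)
    have "cmod (c * iexp (t \<bullet> u)) \<le> 1" for u
      using c by (simp add: norm_mult)
    then have "\<bar>Re (c * iexp (t \<bullet> u))\<bar> \<le> 1" for u
      using abs_Re_le_cmod order_trans by blast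
    then have re: "0 \<le> 1 + Re (c * iexp (t \<bullet> u))" "1 + Re (c * iexp (t \<bullet> u)) \<le> 2" for u
      by (smt (verit))+
    then show "0 \<le> p u * (1 + Re (c * iexp (t \<bullet> u)))" "p u * (1 + Re (c * iexp (t \<bullet> u))) \<le> 2" for u
      using p01[of u] mult_mono[OF p01(2) re(2) _ re(1), of u u] by auto
    fix s :: real
    \<comment> \<open>Writing the real part as half the sum of a number and its conjugate leaves
      integrals of \<open>p\<close> against exponentials of frequencies \<open>s j\<close>,
      \<open>s j + t\<close> and \<open>s j - t\<close>. The induction hypothesis covers all three
      because it is stated for arbitrary \<open>t\<close>.\<close>
    have I: "(CLINT u|Q. (p u * (1 + Re (c * iexp (t \<bullet> u)))) *\<^sub>R iexp (s * (u \<bullet> j))) =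
        (CLINT u|Q. p u *\<^sub>R iexp ((s *\<^sub>R j) \<bullet> u)) + c / 2 * (CLINT u|Q. p u *\<^sub>R iexp ((s *\<^sub>R j + t) \<bullet> u))
        + cnj c / 2 * (CLINT u|Q. p u *\<^sub>R iexp ((s *\<^sub>R j - t) \<bullet> u))"
      if Q: "prob_space Q" "sets Q = sets borel" for Q
    proof -
      have re: "complex_of_real (Re z) = (z + cnj z) / 2" for z
        by (simp add: complex_eq_iff)
      have "complex_of_real (Re (c * iexp (t \<bullet> u))) = (c * iexp (t \<bullet> u) + cnj c * iexp (- (t \<bullet> u))) / 2" for u
        by (simp only: re complex_cnj_mult exp_cnj) simp
      moreover have "(p u * (1 + r)) *\<^sub>R z = complex_of_real (p u) * (1 + complex_of_real r) * z" for u r z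
        by (simp add: scaleR_conv_of_real)
      ultimately have "(p u * (1 + Re (c * iexp (t \<bullet> u)))) *\<^sub>R iexp (s * (u \<bullet> j)) =
        p u *\<^sub>R iexp ((s *\<^sub>R j) \<bullet> u) + c / 2 * (p u *\<^sub>R iexp ((s *\<^sub>R j + t) \<bullet> u))
        + cnj c / 2 * (p u *\<^sub>R iexp ((s *\<^sub>R j - t) \<bullet> u))" for u
        by (simp only:) (simp add: scaleR_conv_of_real field_simps inner_simps exp_add exp_diff exp_minus inner_commute[of u j])
      then have "(CLINT u|Q. (p u * (1 + Re (c * iexp (t \<bullet> u)))) *\<^sub>R iexp (s * (u \<bullet> j))) =
        (CLINT u|Q. p u *\<^sub>R iexp ((s *\<^sub>R j) \<bullet> u) + c / 2 * (p u *\<^sub>R iexp ((s *\<^sub>R j + t) \<bullet> u))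
        + cnj c / 2 * (p u *\<^sub>R iexp ((s *\<^sub>R j - t) \<bullet> u)))"
        by presburger
      also have "\<dots> = (CLINT u|Q. p u *\<^sub>R iexp ((s *\<^sub>R j) \<bullet> u)) + c / 2 * (CLINT u|Q. p u *\<^sub>R iexp ((s *\<^sub>R j + t) \<bullet> u))
        + cnj c / 2 * (CLINT u|Q. p u *\<^sub>R iexp ((s *\<^sub>R j - t) \<bullet> u))"
        by (simp only: Bochner_Integration.integral_add Bochner_Integration.integrable_add
            integral_mult_right_zero Bochner_Integration.integrable_mult_right int[OF Q])
      finally show ?thesis .
    qed
    show "(CLINT u|M. (p u * (1 + Re (c * iexp (t \<bullet> u)))) *\<^sub>R iexp (s * (u \<bullet> j))) =
        (CLINT u|N. (p u * (1 + Re (c * iexp (t \<bullet> u)))) *\<^sub>R iexp (s * (u \<bullet> j)))"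
      unfolding I[OF M] I[OF N] using insert.IH by (simp only: p_def)
  qed measurable
  define g where "g u = (p u * indicator (B j) (u \<bullet> j)) *\<^sub>R iexp (t \<bullet> u)" for u
  have W: "(LINT u|Q. (p u * (1 + Re (c * iexp (t \<bullet> u)))) * indicator (B j) (u \<bullet> j)) =
      (LINT u|Q. p u * indicator (B j) (u \<bullet> j)) + Re (c * (CLINT u|Q. g u)) \<and> integrable Q g"
    if Q: "prob_space Q" "sets Q = sets borel" for Q c
  proof -
    note Q(2) [measurable_cong]
    interpret prob_space Q by fact
    have g: "integrable Q g"
      unfolding g_def using p01 by (intro integrable_const_bound[where B = 1]) (auto simp: indicator_def)
    have i: "integrable Q (\<lambda>u. p u * indicator (B j) (u \<bullet> j))"
      using p01 by (intro integrable_const_bound[where B = 1]) (auto simp: indicator_def)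
    have "(p u * (1 + Re (c * iexp (t \<bullet> u)))) * indicator (B j) (u \<bullet> j) =
      p u * indicator (B j) (u \<bullet> j) + Re (c * g u)" for u
      by (simp add: g_def algebra_simps)
    then have "(LINT u|Q. (p u * (1 + Re (c * iexp (t \<bullet> u)))) * indicator (B j) (u \<bullet> j)) =
      (LINT u|Q. p u * indicator (B j) (u \<bullet> j) + Re (c * g u))" by presburger
    also have "\<dots> = (LINT u|Q. p u * indicator (B j) (u \<bullet> j)) + Re (CLINT u|Q. c * g u)"
      using g i by (subst Bochner_Integration.integral_add) auto
    finally show ?thesis using g by simp
  qed
  have wc: "(LINT u|M. p u * indicator (B j) (u \<bullet> j)) + Re (c * (CLINT u|M. g u)) =
    (LINT u|N. p u * indicator (B j) (u \<bullet> j)) + Re (c * (CLINT u|N. g u))" if "cmod c \<le> 1" for c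
    using w[OF that] W[OF M, of c] W[OF N, of c] by simp
  \<comment> \<open>\<open>c = 0\<close> cancels the terms without exponential; \<open>c = 1\<close>
    then compares the real parts and \<open>c = \<i>\<close> the negated imaginary parts.\<close>
  have "(CLINT u|M. g u) = (CLINT u|N. g u)"
    using wc[of 0] wc[of 1] wc[of "\<i>"] by (simp add: complex_eq_iff)
  moreover have "g u = (\<Prod>j\<in>insert j J. indicator (B j) (u \<bullet> j)) *\<^sub>R iexp (t \<bullet> u)" for u
    using insert.hyps by (simp add: g_def p_def mult.commute)
  ultimately show ?case by simp
qed

text \<open>Open boxes form an intersection-stable generator of the Borel sets. The indicator of a
  box is a product of interval indicators over \<open>Basis\<close>, so the preceding lemma at
  \<open>t = 0\<close> gives its measure.\<close>

lemma char_unique_euclidean: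
  fixes M N :: "'a::euclidean_space measure"
  assumes M: "prob_space M" "sets M = sets borel" and N: "prob_space N" "sets N = sets borel"
    and eq: "\<And>t. (CLINT u|M. iexp (t \<bullet> u)) = (CLINT u|N. iexp (t \<bullet> u))"
  shows "M = N"
proof (rule measure_eqI_generator_eq)
  let ?E = "range (\<lambda>(a, b). box a b::'a set)"
  show "Int_stable ?E"
    by (auto simp: Int_stable_def box_Int_box)
  show "?E \<subseteq> Pow UNIV" "sets M = sigma_sets UNIV ?E" "sets N = sigma_sets UNIV ?E"
    by (simp_all add: borel_eq_box M N)
  let ?A = "\<lambda>n::nat. box (- (real n *\<^sub>R One)) (real n *\<^sub>R One) :: 'a set"
  show "range ?A \<subseteq> ?E" "(\<Union>i. ?A i) = UNIV"
    unfolding UN_box_eq_UNIV by auto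
  interpret M: prob_space M by fact
  interpret N: prob_space N by fact
  show "emeasure M (?A i) \<noteq> \<infinity>" for i by simp
  fix X assume "X \<in> ?E"
  then obtain a b where X: "X = box a b" by auto
  have ind: "indicator X u = (\<Prod>j\<in>Basis. indicator {a \<bullet> j<..<b \<bullet> j} (u \<bullet> j) :: real)" for u :: 'a
    unfolding X by (auto simp: box_def indicator_def)
  have "complex_of_real (LINT u|M. indicator X u) = complex_of_real (LINT u|N. indicator X u)"
    using char_determines_coordinates[OF M N eq, of "\<lambda>j. {a \<bullet> j<..<b \<bullet> j}" Basis 0]
    by (simp add: scaleR_conv_of_real ind del: of_real_prod)
  then show "emeasure M X = emeasure N X"
    using M N X by (simp add: M.emeasure_eq_measure N.emeasure_eq_measure)
qed

section \<open>Gaussian laws\<close>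

lemma matrix_mul_matrix_inv: "invertible A \<Longrightarrow> A ** matrix_inv A = mat 1"
  and matrix_inv_matrix_mul: "invertible A \<Longrightarrow> matrix_inv A ** A = mat 1"
  using someI_ex[of "\<lambda>A'. A ** A' = mat 1 \<and> A' ** A = mat 1"]
  by (auto simp: invertible_def matrix_inv_def)

lemma inner_matrix_vector_mult:
  fixes B :: "real^'n^'m"
  shows "s \<bullet> (B *v g) = (transpose B *v s) \<bullet> g"
  by (simp add: dot_lmul_matrix)

lemma continuous_on_matrix_vector_mult [continuous_intros]:
  fixes B :: "real^'n^'m"
  assumes "continuous_on S f"
  shows "continuous_on S (\<lambda>u. B *v f u)"
  using linear_continuous_on[of "(*v) B"] assms
  by (auto intro: continuous_on_compose2 simp: linear_linear)

lemma borel_measurable_matrix_vector_mult [measurable (raw)]: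
  fixes B :: "real^'n^'m"
  assumes "f \<in> borel_measurable M"
  shows "(\<lambda>u. B *v f u) \<in> borel_measurable M"
  by (rule measurable_compose[OF assms])
     (intro borel_measurable_continuous_onI continuous_intros)

lemma matrix_mul_add_rdistrib:
  fixes A B :: "real^'n^'m" and C :: "real^'k^'n"
  shows "(A + B) ** C = A ** C + B ** C"
  by (simp add: matrix_eq matrix_vector_mult_add_rdistrib flip: matrix_vector_mul_assoc)

section \<open>Characteristic functions of Gaussian laws, and the standard Gaussian measure\<close>

lemma char_normal_law:
  assumes "0 \<le> v"
  shows "char (normal_law m v) s = iexp (s * m) * complex_of_real (exp (- (s\<^sup>2 * v) / 2))"
proof (cases "v = 0")
  case True
  then show ?thesis by (simp add: normal_law_def char_def integral_return)
next
  case False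
  with assms have v: "0 < v" by simp
  interpret prob_space std_normal_distribution
    by (rule prob_space_normal_density) simp
  have "distributed std_normal_distribution lborel (\<lambda>x. x) std_normal_density"
    by (auto simp: distributed_def distr_id2)
  \<comment> \<open>For positive variance the law is the image of the standard normal law under
    scaling by the standard deviation \<open>sqrt v\<close> and shifting by
    \<open>m\<close>.\<close>
  from normal_density_affine[OF this, of "sqrt v" m] v
  have "distr std_normal_distribution lborel (\<lambda>x. m + sqrt v * x) = density lborel (normal_density m (sqrt v))"
    by (simp add: distributed_def)
  also have "\<dots> = normal_law m v"
    using v by (simp add: normal_law_def)
  also have "distr std_normal_distribution lborel (\<lambda>x. m + sqrt v * x)
      = distr std_normal_distribution borel (\<lambda>x. m + sqrt v * x)"
    by (intro distr_cong) auto
  finally have nl: "normal_law m v = distr std_normal_distribution borel (\<lambda>x. m + sqrt v * x)"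
    by (rule sym)
  have "char (normal_law m v) s = (CLINT x|std_normal_distribution. iexp (s * (m + sqrt v * x)))"
    unfolding nl char_def by (intro integral_distr) auto
  also have "\<dots> = (CLINT x|std_normal_distribution. iexp (s * m) * iexp ((s * sqrt v) * x))"
    by (simp add: algebra_simps exp_add)
  also have "\<dots> = iexp (s * m) * char std_normal_distribution (s * sqrt v)"
    by (simp add: char_def)
  finally show ?thesis using v
    by (simp add: char_std_normal_distribution power_mult_distrib)
qed

text \<open>The value at \<open>t\<close> is the univariate characteristic function of the
  functional \<open>t \<bullet> u\<close> at the argument 1.\<close>

lemma char_gaussian_law:
  assumes "gaussian_law \<mu> S N"
  shows "(CLINT u|N. iexp (t \<bullet> u)) = iexp (t \<bullet> \<mu>) * complex_of_real (exp (- (t \<bullet> (S *v t)) / 2))"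
proof -
  have [measurable_cong]: "sets N = sets borel" and v: "0 \<le> t \<bullet> (S *v t)"
    and d: "distr N borel (\<lambda>u. t \<bullet> u) = normal_law (t \<bullet> \<mu>) (t \<bullet> (S *v t))"
    using assms by (auto simp: gaussian_law_def pos_semidef_def)
  have "(CLINT u|N. iexp (t \<bullet> u)) = char (distr N borel (\<lambda>u. t \<bullet> u)) 1"
    by (simp add: char_def integral_distr)
  then show ?thesis unfolding d char_normal_law[OF v] by simp
qed

text \<open>The law of a vector with independent standard normal coordinates. The product measure
  lives on functions on \<open>Basis\<close> and is carried over to the Euclidean space, so product
  integral formulas apply.\<close>

definition std_gaussian :: "'a::euclidean_space measure" where
  "std_gaussian = distr (\<Pi>\<^sub>M b\<in>Basis. std_normal_distribution) borel (\<lambda>f. \<Sum>b\<in>Basis. f b *\<^sub>R b)"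

lemma sets_std_gaussian [simp, measurable_cong]: "sets std_gaussian = sets borel"
  by (simp add: std_gaussian_def)

lemma space_std_gaussian [simp]: "space std_gaussian = UNIV"
  by (simp add: std_gaussian_def)

lemma measurable_std_gaussian_sum [measurable]:
  "(\<lambda>f. \<Sum>b\<in>Basis. f b *\<^sub>R b) \<in> (\<Pi>\<^sub>M b\<in>Basis. std_normal_distribution) \<rightarrow>\<^sub>M (borel :: 'a::euclidean_space measure)"
proof (rule borel_measurable_sum)
  fix b :: 'a assume [measurable]: "b \<in> Basis"
  have "(\<lambda>f. f b) \<in> (\<Pi>\<^sub>M b\<in>Basis. std_normal_distribution) \<rightarrow>\<^sub>M std_normal_distribution"
    by measurable
  then have [measurable]: "(\<lambda>f. f b) \<in> borel_measurable (\<Pi>\<^sub>M b\<in>Basis. std_normal_distribution)"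
    by (simp cong: measurable_cong_sets)
  show "(\<lambda>f. f b *\<^sub>R b) \<in> borel_measurable (\<Pi>\<^sub>M b\<in>Basis. std_normal_distribution)"
    by measurable
qed

lemma prob_space_std_gaussian: "prob_space std_gaussian"
  unfolding std_gaussian_def
  by (intro prob_space.prob_space_distr prob_space_PiM prob_space_normal_density
      measurable_std_gaussian_sum) simp

lemma char_std_gaussian:
  fixes t :: "'a::euclidean_space"
  shows "(CLINT u|std_gaussian. iexp (t \<bullet> u)) = complex_of_real (exp (- (t \<bullet> t) / 2))"
proof -
  interpret product_prob_space "\<lambda>_::'a. std_normal_distribution" Basis
    by (intro product_prob_spaceI prob_space_normal_density) simp
  have "(CLINT u|std_gaussian. iexp (t \<bullet> u)) =
      (CLINT f|(\<Pi>\<^sub>M b\<in>(Basis::'a set). std_normal_distribution). iexp (t \<bullet> (\<Sum>b\<in>Basis. f b *\<^sub>R b)))"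
    unfolding std_gaussian_def by (intro integral_distr) measurable
  also have "\<dots> = (CLINT f|(\<Pi>\<^sub>M b\<in>(Basis::'a set). std_normal_distribution). (\<Prod>b\<in>Basis. iexp ((t \<bullet> b) * f b)))"
    by (simp add: inner_sum_right exp_sum sum_distrib_left mult_ac)
  also have "\<dots> = (\<Prod>b\<in>Basis. char std_normal_distribution (t \<bullet> b))"
    unfolding char_def
    by (intro product_integral_prod) (auto intro!: prob_space.integrable_iexp prob_space_normal_density)
  also have "\<dots> = complex_of_real (exp (\<Sum>b\<in>Basis. - (t \<bullet> b)\<^sup>2 / 2))"
    by (simp add: char_std_normal_distribution exp_sum)
  also have "(\<Sum>b\<in>Basis. - (t \<bullet> b)\<^sup>2 / 2) = - (t \<bullet> t) / 2"
    by (subst euclidean_inner) (simp add: power2_eq_square sum_negf sum_divide_distrib)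
  finally show ?thesis .
qed

text \<open>An open set around a point contains a box, whose mass is a product of interval masses of
  the standard normal law.\<close>

lemma std_gaussian_open_nonnull:
  fixes U :: "'a::euclidean_space set"
  assumes U: "open U" "U \<noteq> {}"
  shows "emeasure std_gaussian U \<noteq> 0"
proof -
  interpret product_prob_space "\<lambda>_::'a. std_normal_distribution" Basis
    by (intro product_prob_spaceI prob_space_normal_density) simp
  let ?P = "\<Pi>\<^sub>M b\<in>(Basis::'a set). std_normal_distribution"
  obtain p a b where box: "p \<in> box a b" "box a b \<subseteq> U"
    using U open_contains_box by (metis ex_in_conv)
  have ivl: "emeasure std_normal_distribution {a \<bullet> i<..<b \<bullet> i} \<noteq> 0" if "i \<in> Basis" for i
  proof
    assume "emeasure std_normal_distribution {a \<bullet> i<..<b \<bullet> i} = 0"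
    then have "{a \<bullet> i<..<b \<bullet> i} \<in> null_sets std_normal_distribution" by auto
    then have "AE x in lborel. x \<in> {a \<bullet> i<..<b \<bullet> i} \<longrightarrow> ennreal (std_normal_density x) = 0"
      by (subst (asm) null_sets_density_iff) auto
    \<comment> \<open>The density is strictly positive, so an interval null for the normal law would
      be Lebesgue null, although \<open>a \<bullet> i < b \<bullet> i\<close>.\<close>
    then have "AE x in lborel. x \<notin> {a \<bullet> i<..<b \<bullet> i}"
    proof eventually_elim
      fix x
      have "0 < std_normal_density x" by (simp add: normal_density_pos)
      then show "x \<in> {a \<bullet> i<..<b \<bullet> i} \<longrightarrow> ennreal (std_normal_density x) = 0 \<Longrightarrow> x \<notin> {a \<bullet> i<..<b \<bullet> i}"
        by (metis ennreal_eq_0_iff not_le)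
    qed
    then have "{a \<bullet> i<..<b \<bullet> i} \<in> null_sets lborel"
      by (subst AE_iff_null_sets) auto
    moreover have "a \<bullet> i < b \<bullet> i" using box that by (auto simp: box_def intro: less_trans)
    ultimately show False by (simp add: null_sets_def)
  qed
  have "0 < emeasure ?P {f \<in> space ?P. \<forall>i\<in>Basis. f i \<in> {a \<bullet> i<..<b \<bullet> i}}"
    unfolding zero_less_iff_neq_zero using ivl by (subst emeasure_PiM_Collect) auto
  also have "emeasure ?P {f \<in> space ?P. \<forall>i\<in>Basis. f i \<in> {a \<bullet> i<..<b \<bullet> i}} \<le>
      emeasure ?P ((\<lambda>f. \<Sum>b\<in>Basis. f b *\<^sub>R b) -` U \<inter> space ?P)"
    using U box(2) by (intro emeasure_mono) (auto simp: subset_eq box_def intro!: measurable_sets[OF measurable_std_gaussian_sum])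
  finally show ?thesis
    using U by (simp add: std_gaussian_def emeasure_distr zero_less_iff_neq_zero)
qed

section \<open>Affine images, decompositions and supports of Gaussian laws\<close>

lemma real_distribution_normal_law: "0 \<le> v \<Longrightarrow> real_distribution (normal_law m v)"
  by (auto simp: normal_law_def real_distribution_def real_distribution_axioms_def
      intro!: prob_space_return prob_space_normal_density)

text \<open>The functional \<open>t\<close> of the image is a constant plus the functional
  \<open>transpose B *v t\<close> of the original vector. \<open>B\<close> may be rectangular or
  singular, so this covers the observation as well as the kernel at a point.\<close>

lemma gaussian_law_affine:
  fixes B :: "real^'n^'m"
  assumes N: "gaussian_law m S N" "prob_space N"
  shows "gaussian_law (a + B *v m) (B ** S ** transpose B) (distr N borel (\<lambda>u. a + B *v u))"
proof -
  have [measurable_cong]: "sets N = sets borel" and S: "pos_semidef S"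
    using N by (auto simp: gaussian_law_def)
  interpret prob_space N by fact
  \<comment> \<open>This identity yields both semidefiniteness and the variance of the functional
    \<open>t\<close>.\<close>
  have q: "t \<bullet> ((B ** S ** transpose B) *v t) = (transpose B *v t) \<bullet> (S *v (transpose B *v t))" for t
    by (simp only: inner_matrix_vector_mult flip: matrix_vector_mul_assoc)
  have psd: "pos_semidef (B ** S ** transpose B)"
    using S by (simp only: pos_semidef_def q) (simp add: matrix_transpose_mul matrix_mul_assoc)
  have "distr (distr N borel (\<lambda>u. a + B *v u)) borel (\<lambda>u. t \<bullet> u) =
      normal_law (t \<bullet> (a + B *v m)) (t \<bullet> ((B ** S ** transpose B) *v t))" for t
  proof (rule Levy_uniqueness)
    have "prob_space (distr N borel (\<lambda>u. a + B *v u))" by (rule prob_space_distr) measurable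
    then show "real_distribution (distr (distr N borel (\<lambda>u. a + B *v u)) borel (\<lambda>u. t \<bullet> u))"
      by (rule prob_space.real_distribution_distr) measurable
    have v0: "0 \<le> t \<bullet> ((B ** S ** transpose B) *v t)"
      using psd by (simp only: pos_semidef_def)
    then show "real_distribution (normal_law (t \<bullet> (a + B *v m)) (t \<bullet> ((B ** S ** transpose B) *v t)))"
      by (rule real_distribution_normal_law)
    show "char (distr (distr N borel (\<lambda>u. a + B *v u)) borel (\<lambda>u. t \<bullet> u)) =
      char (normal_law (t \<bullet> (a + B *v m)) (t \<bullet> ((B ** S ** transpose B) *v t)))"
    proof
      fix s :: real
      \<comment> \<open>The scalar argument \<open>s\<close> is absorbed into the functional, so
        that \<open>char_gaussian_law\<close> applies at \<open>?r\<close>.\<close>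
      let ?r = "s *\<^sub>R (transpose B *v t)"
      have "char (distr (distr N borel (\<lambda>u. a + B *v u)) borel (\<lambda>u. t \<bullet> u)) s =
          (CLINT u|N. iexp (s * (t \<bullet> (a + B *v u))))"
        by (simp add: char_def integral_distr)
      also have "\<dots> = (CLINT u|N. iexp (s * (t \<bullet> a)) * iexp (?r \<bullet> u))"
        by (simp add: inner_add_right inner_matrix_vector_mult algebra_simps exp_add
            del: transpose_matrix_vector)
      also have "\<dots> = iexp (s * (t \<bullet> a)) * (iexp (?r \<bullet> m) * complex_of_real (exp (- (?r \<bullet> (S *v ?r)) / 2)))"
        by (simp only: integral_mult_right_zero char_gaussian_law[OF N(1)])
      also have "?r \<bullet> (S *v ?r) = s\<^sup>2 * (t \<bullet> ((B ** S ** transpose B) *v t))"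
        by (simp only: q) (simp add: power2_eq_square matrix_vector_mult_scaleR
            del: transpose_matrix_vector)
      also have "?r \<bullet> m = s * (t \<bullet> (B *v m))"
        by (simp add: inner_matrix_vector_mult del: transpose_matrix_vector)
      finally show "char (distr (distr N borel (\<lambda>u. a + B *v u)) borel (\<lambda>u. t \<bullet> u)) s =
          char (normal_law (t \<bullet> (a + B *v m)) (t \<bullet> ((B ** S ** transpose B) *v t))) s"
        by (simp only: char_normal_law[OF v0]) (simp add: inner_add_right distrib_left exp_add)
    qed
  qed
  with psd show ?thesis by (simp add: gaussian_law_def)
qed

text \<open>By independence of \<open>u\<close> and \<open>v\<close> the characteristic function of
  \<open>P *v u + Q *v v\<close> factors. The means add up to \<open>(P + Q) *v m = m\<close> and
  the covariances to \<open>S\<close>.\<close>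

lemma gaussian_law_decompose:
  fixes P Q :: "real^'n^'n"
  assumes N: "gaussian_law m S N" "prob_space N"
    and PQ: "P + Q = mat 1" and S: "P ** S ** transpose P + Q ** S ** transpose Q = S"
  shows "distr (N \<Otimes>\<^sub>M N) borel (\<lambda>(u, v). P *v u + Q *v v) = N"
proof (rule char_unique_euclidean)
  have sN [measurable_cong]: "sets N = sets borel"
    using N by (auto simp: gaussian_law_def)
  then show "sets N = sets borel" .
  interpret prob_space N by fact
  interpret NN: pair_prob_space N N ..
  show "prob_space N" by fact
  show "prob_space (distr (N \<Otimes>\<^sub>M N) borel (\<lambda>(u, v). P *v u + Q *v v))"
    by (rule NN.P.prob_space_distr) measurable
  fix t
  have law: "(CLINT u|N. iexp (t \<bullet> (B *v u))) =
      iexp (t \<bullet> (B *v m)) * complex_of_real (exp (- (t \<bullet> ((B ** S ** transpose B) *v t)) / 2))" for B :: "real^'n^'n"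
    using char_gaussian_law[OF gaussian_law_affine[OF N, of 0 B], of t]
    by (simp add: integral_distr)
  have "(CLINT w|distr (N \<Otimes>\<^sub>M N) borel (\<lambda>(u, v). P *v u + Q *v v). iexp (t \<bullet> w)) =
      (CLINT w|N \<Otimes>\<^sub>M N. iexp (t \<bullet> (P *v fst w)) * iexp (t \<bullet> (Q *v snd w)))"
    by (simp add: integral_distr case_prod_beta inner_add_right distrib_left exp_add)
  \<comment> \<open>Fubini applies because the integrand has modulus 1.\<close>
  also have "\<dots> = (CLINT u|N. CLINT v|N. iexp (t \<bullet> (P *v u)) * iexp (t \<bullet> (Q *v v)))"
    by (subst NN.integral_fst'[symmetric])
       (auto intro!: NN.P.integrable_const_bound[where B = 1] simp: norm_mult)
  also have "\<dots> = (CLINT u|N. iexp (t \<bullet> (P *v u))) * (CLINT v|N. iexp (t \<bullet> (Q *v v)))"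
    by simp
  also have "\<dots> = iexp (t \<bullet> ((P + Q) *v m)) *
      complex_of_real (exp (- (t \<bullet> ((P ** S ** transpose P + Q ** S ** transpose Q) *v t)) / 2))"
  proof -
    have "exp (- (a + c) / 2) = exp (- a / 2) * exp (- c / 2)" for a c :: real
      by (simp add: field_simps flip: exp_add)
    then show ?thesis
      unfolding law by (simp add: matrix_vector_mult_add_rdistrib inner_add_right distrib_left exp_add)
  qed
  also have "\<dots> = (CLINT u|N. iexp (t \<bullet> u))"
    unfolding S PQ char_gaussian_law[OF N(1)] by simp
  finally show "(CLINT w|distr (N \<Otimes>\<^sub>M N) borel (\<lambda>(u, v). P *v u + Q *v v). iexp (t \<bullet> w)) =
    (CLINT u|N. iexp (t \<bullet> u))" .
qed simp

text \<open>\<open>N\<close> is the image of the standard Gaussian under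
  \<open>g \<mapsto> m + B *v g\<close>, which is continuous and, as \<open>B\<close> is invertible,
  onto. Preimages of nonempty open sets are thus open and nonempty.\<close>

lemma gaussian_law_open_nonnull:
  fixes B :: "real^'n^'n"
  assumes N: "gaussian_law m (B ** transpose B) N" "prob_space N" and B: "invertible B"
    and U: "open U" "U \<noteq> {}"
  shows "emeasure N U \<noteq> 0"
proof -
  have sN: "sets N = sets borel" using N by (simp add: gaussian_law_def)
  have cont: "continuous_on UNIV (\<lambda>g. m + B *v g)"
    by (intro continuous_intros)
  then have [measurable]: "(\<lambda>g. m + B *v g) \<in> borel_measurable borel"
    by (rule borel_measurable_continuous_onI)
  have "N = distr std_gaussian borel (\<lambda>g. m + B *v g)"
  proof (rule char_unique_euclidean[OF N(2) sN])
    show "prob_space (distr std_gaussian borel (\<lambda>g. m + B *v g))"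
      by (intro prob_space.prob_space_distr prob_space_std_gaussian) measurable
    fix t :: "real^'n"
    have "(CLINT u|distr std_gaussian borel (\<lambda>g. m + B *v g). iexp (t \<bullet> u)) =
        (CLINT g|std_gaussian. iexp (t \<bullet> m) * iexp ((transpose B *v t) \<bullet> g))"
      by (simp add: integral_distr inner_add_right inner_matrix_vector_mult algebra_simps exp_add
          del: transpose_matrix_vector)
    also have "\<dots> = iexp (t \<bullet> m) * complex_of_real (exp (- ((transpose B *v t) \<bullet> (transpose B *v t)) / 2))"
      by (simp add: char_std_gaussian)
    also have "(transpose B *v t) \<bullet> (transpose B *v t) = t \<bullet> ((B ** transpose B) *v t)"
      by (simp only: inner_matrix_vector_mult flip: matrix_vector_mul_assoc)
    finally show "(CLINT u|N. iexp (t \<bullet> u)) = (CLINT u|distr std_gaussian borel (\<lambda>g. m + B *v g). iexp (t \<bullet> u))"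
      by (simp add: char_gaussian_law[OF N(1)])
  qed simp
  moreover have "open ((\<lambda>g. m + B *v g) -` U)"
    using cont U by (simp add: open_vimage)
  moreover have "(\<lambda>g. m + B *v g) -` U \<noteq> {}"
  proof -
    obtain u where "u \<in> U" using U by auto
    moreover have "m + B *v (matrix_inv B *v (u - m)) = u"
      using B by (simp add: matrix_vector_mul_assoc matrix_mul_matrix_inv)
    ultimately show ?thesis by (metis empty_iff vimageI)
  qed
  ultimately show ?thesis
    using U std_gaussian_open_nonnull by (simp add: emeasure_distr)
qed

section \<open>Weakly continuous conditional distributions\<close>

text \<open>Extends the defining identity of the kernel from indicators of sets \<open>C\<close> to
  nonnegative measurable functions.\<close>

lemma regular_cond_dist_nn_integral:
  fixes f :: "'x::topological_space \<Rightarrow> ennreal"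
  assumes X [measurable]: "X \<in> borel_measurable M" and Y [measurable]: "Y \<in> borel_measurable M"
    and K: "regular_cond_dist M X Y K" and f [measurable]: "f \<in> borel_measurable borel"
    and B [measurable]: "B \<in> sets borel"
  shows "(\<integral>\<^sup>+ z \<in> B. (\<integral>\<^sup>+ u. f u \<partial>K z) \<partial>distr M borel Y) = (\<integral>\<^sup>+ \<omega>. indicator B (Y \<omega>) * f (X \<omega>) \<partial>M)"
proof -
  have Kp: "K \<in> borel \<rightarrow>\<^sub>M prob_algebra borel" using K by (simp add: regular_cond_dist_def)
  have Ks [measurable]: "K \<in> borel \<rightarrow>\<^sub>M subprob_algebra borel"
    using Kp by (rule measurable_prob_algebraD)
  define \<nu> where "\<nu> = density (distr M borel Y) (indicator B)"
  have s\<nu> [measurable_cong]: "sets \<nu> = sets borel" by (simp add: \<nu>_def)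
  have ne: "space \<nu> \<noteq> {}" by (simp add: \<nu>_def)
  \<comment> \<open>Restricting the law of \<open>Y\<close> to \<open>B\<close> turns the
    disintegration into an equality of measures: mixing \<open>K\<close> over \<open>\<nu>\<close>
    gives the law of \<open>X\<close> on the event that \<open>Y\<close> lies in
    \<open>B\<close>.\<close>
  have eq: "\<nu> \<bind> K = distr (density M (\<lambda>\<omega>. indicator B (Y \<omega>))) borel X"
  proof (rule measure_eqI)
    show s: "sets (\<nu> \<bind> K) = sets (distr (density M (\<lambda>\<omega>. indicator B (Y \<omega>))) borel X)"
      using ne by (subst sets_bind[where N = borel]) (auto simp: sets_kernel[OF Ks])
    fix C assume "C \<in> sets (\<nu> \<bind> K)"
    then have C [measurable]: "C \<in> sets borel" by (simp add: s)
    have "emeasure (\<nu> \<bind> K) C = (\<integral>\<^sup>+ z. emeasure (K z) C \<partial>\<nu>)"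
      using ne by (subst emeasure_bind[where N = borel]) auto
    also have "\<dots> = (\<integral>\<^sup>+ z \<in> B. emeasure (K z) C \<partial>distr M borel Y)"
      unfolding \<nu>_def by (subst nn_integral_density) (auto simp: mult.commute)
    also have "\<dots> = emeasure M {\<omega> \<in> space M. Y \<omega> \<in> B \<and> X \<omega> \<in> C}"
      using K by (simp add: regular_cond_dist_def)
    also have "\<dots> = (\<integral>\<^sup>+ \<omega>. indicator {\<omega> \<in> space M. Y \<omega> \<in> B \<and> X \<omega> \<in> C} \<omega> \<partial>M)"
      by simp
    also have "\<dots> = (\<integral>\<^sup>+ \<omega>. indicator B (Y \<omega>) * indicator (X -` C \<inter> space M) \<omega> \<partial>M)"
      by (intro nn_integral_cong) (auto simp: indicator_def)
    also have "\<dots> = emeasure (distr (density M (\<lambda>\<omega>. indicator B (Y \<omega>))) borel X) C"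
      by (simp add: emeasure_distr emeasure_density)
    finally show "emeasure (\<nu> \<bind> K) C = \<dots>" .
  qed
  have "(\<integral>\<^sup>+ z \<in> B. (\<integral>\<^sup>+ u. f u \<partial>K z) \<partial>distr M borel Y) = (\<integral>\<^sup>+ z. (\<integral>\<^sup>+ u. f u \<partial>K z) \<partial>\<nu>)"
    unfolding \<nu>_def by (subst nn_integral_density) (auto simp: mult.commute)
  also have "\<dots> = (\<integral>\<^sup>+ u. f u \<partial>(\<nu> \<bind> K))"
    by (subst nn_integral_bind[where B = borel]) auto
  also have "\<dots> = (\<integral>\<^sup>+ \<omega>. indicator B (Y \<omega>) * f (X \<omega>) \<partial>M)"
    unfolding eq by (simp add: nn_integral_distr nn_integral_density)
  finally show ?thesis .
qed

text \<open>Both integrals, as functions of \<open>z\<close>, are densities with respect to the law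
  of \<open>Y\<close> of the same finite measure, so they agree almost everywhere. Continuity and
  full support upgrade this to every \<open>z\<close>.\<close>

lemma weakly_continuous_cond_dist_integral_unique:
  fixes f :: "'x::topological_space \<Rightarrow> real" and Y :: "'w \<Rightarrow> 'y::topological_space"
  assumes M: "prob_space M" and X [measurable]: "X \<in> borel_measurable M"
    and Y [measurable]: "Y \<in> borel_measurable M"
    and K: "regular_cond_dist M X Y K" "weakly_continuous_kernel K"
    and L: "regular_cond_dist M X Y L" "weakly_continuous_kernel L"
    and pos: "\<And>U. open U \<Longrightarrow> U \<noteq> {} \<Longrightarrow> emeasure (distr M borel Y) U \<noteq> 0"
    and f: "continuous_on UNIV f" "\<And>u. 0 \<le> f u" "\<And>u. f u \<le> c"
  shows "(LINT u|K z. f u) = (LINT u|L z. f u)"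
proof -
  let ?\<nu> = "distr M borel Y"
  have [measurable]: "f \<in> borel_measurable borel"
    using f(1) by (rule borel_measurable_continuous_onI)
  have bdd: "bounded (range f)"
    using f by (auto simp: bounded_iff intro!: exI[of _ c])
  define F where "F Q z = (LINT u|Q z. f u)" for Q :: "'y \<Rightarrow> 'x measure" and z
  have F: "continuous_on UNIV (F Q) \<and> (\<forall>z. (\<integral>\<^sup>+u. ennreal (f u) \<partial>Q z) = ennreal (F Q z) \<and> 0 \<le> F Q z)"
    if Q: "regular_cond_dist M X Y Q" "weakly_continuous_kernel Q" for Q
  proof -
    have "(\<integral>\<^sup>+u. ennreal (f u) \<partial>Q z) = ennreal (F Q z)" for z
    proof -
      have Qz: "prob_space (Q z)" "sets (Q z) = sets borel"
        using measurable_space[of Q borel "prob_algebra borel" z] Q(1)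
        by (auto simp: regular_cond_dist_def space_prob_algebra)
      note Qz(2) [measurable_cong]
      show ?thesis unfolding F_def using f
        by (intro nn_integral_eq_integral finite_measure.integrable_const_bound[where B = c]
            prob_space.finite_measure Qz) auto
    qed
    then show ?thesis
      using Q(2) f bdd by (auto simp: weakly_continuous_kernel_def F_def)
  qed
  have [measurable]: "F K \<in> borel_measurable borel" "F L \<in> borel_measurable borel"
    using F K L by (auto intro!: borel_measurable_continuous_onI)
  interpret prob_space M by fact
  interpret \<nu>: prob_space ?\<nu> by (rule prob_space_distr) fact
  have "AE z in ?\<nu>. ennreal (F K z) = ennreal (F L z)"
  proof (rule \<nu>.density_unique_finite_measure)
    fix B assume "B \<in> sets ?\<nu>"
    then have B: "B \<in> sets borel" by simp
    show "(\<integral>\<^sup>+z\<in>B. ennreal (F K z) \<partial>?\<nu>) = (\<integral>\<^sup>+z\<in>B. ennreal (F L z) \<partial>?\<nu>)"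
      using F[OF K] F[OF L] regular_cond_dist_nn_integral[OF X Y K(1) _ B, of "\<lambda>u. ennreal (f u)"]
        regular_cond_dist_nn_integral[OF X Y L(1) _ B, of "\<lambda>u. ennreal (f u)"]
      by simp
  qed auto
  then have ae: "AE z in ?\<nu>. F K z = F L z"
    by eventually_elim (use F[OF K] F[OF L] in auto)
  \<comment> \<open>The set of disagreement is open and null, hence empty by
    \<open>pos\<close>.\<close>
  have op: "open {z. F K z \<noteq> F L z}"
    using F[OF K] F[OF L] by (intro open_Collect_neq) auto
  have "emeasure ?\<nu> {z. F K z \<noteq> F L z} = 0"
    using AE_iff_measurable[OF _ refl, of "?\<nu>" "\<lambda>z. F K z = F L z"] ae op by simp
  then have "{z. F K z \<noteq> F L z} = {}"
    using pos[OF op] by blast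
  then show ?thesis by (auto simp: F_def)
qed

text \<open>The kernels are compared through their characteristic functions, whose real and
  imaginary parts are integrals of the bounded continuous functions
  \<open>cos (t \<bullet> u)\<close> and \<open>sin (t \<bullet> u)\<close>.\<close>

lemma weakly_continuous_cond_dist_unique:
  fixes X :: "'w \<Rightarrow> 'x::euclidean_space" and Y :: "'w \<Rightarrow> 'y::topological_space"
  assumes M: "prob_space M" and X: "X \<in> borel_measurable M" and Y: "Y \<in> borel_measurable M"
    and K: "regular_cond_dist M X Y K" "weakly_continuous_kernel K"
    and L: "regular_cond_dist M X Y L" "weakly_continuous_kernel L"
    and pos: "\<And>U. open U \<Longrightarrow> U \<noteq> {} \<Longrightarrow> emeasure (distr M borel Y) U \<noteq> 0"
  shows "K z = L z"
proof -
  have P: "prob_space (Q z) \<and> sets (Q z) = sets borel"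
    if "regular_cond_dist M X Y Q" for Q
    using measurable_space[of Q borel "prob_algebra borel" z] that
    by (auto simp: regular_cond_dist_def space_prob_algebra)
  have C: "(LINT u|Q z. 1 + g (t \<bullet> u)) = 1 + (LINT u|Q z. g (t \<bullet> u))"
    "integrable (Q z) (\<lambda>u. iexp (t \<bullet> u))"
    if Q: "regular_cond_dist M X Y Q" and g: "g \<in> borel_measurable borel" "\<And>s. \<bar>g s\<bar> \<le> 1"
    for Q t and g :: "real \<Rightarrow> real"
  proof -
    note P[OF Q, THEN conjunct2, measurable_cong] g(1) [measurable]
    interpret prob_space "Q z" using P[OF Q] by simp
    have "integrable (Q z) (\<lambda>u. g (t \<bullet> u))"
      using g by (intro integrable_const_bound[where B = 1]) auto
    then show "(LINT u|Q z. 1 + g (t \<bullet> u)) = 1 + (LINT u|Q z. g (t \<bullet> u))"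
      by (simp add: prob_space)
    show "integrable (Q z) (\<lambda>u. iexp (t \<bullet> u))"
      by (intro integrable_const_bound[where B = 1]) auto
  qed
  have U: "(LINT u|K z. g (t \<bullet> u)) = (LINT u|L z. g (t \<bullet> u))"
    if g: "continuous_on UNIV g" "\<And>s. \<bar>g s\<bar> \<le> 1" for g :: "real \<Rightarrow> real" and t
  proof -
    \<comment> \<open>Adding 1 makes the test function nonnegative, as the preceding lemma demands;
      \<open>C\<close> removes the constant again.\<close>
    have "(LINT u|K z. 1 + g (t \<bullet> u)) = (LINT u|L z. 1 + g (t \<bullet> u))"
    proof (rule weakly_continuous_cond_dist_integral_unique[OF M X Y K L pos])
      show "continuous_on UNIV (\<lambda>u. 1 + g (t \<bullet> u))"
        by (intro continuous_intros continuous_on_compose2[OF g(1)]) auto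
      show "0 \<le> 1 + g (t \<bullet> u)" "1 + g (t \<bullet> u) \<le> 2" for u
        using g(2)[of "t \<bullet> u"] by auto
    qed
    then show ?thesis
      using C(1)[OF K(1) borel_measurable_continuous_onI[OF g(1)] g(2)]
        C(1)[OF L(1) borel_measurable_continuous_onI[OF g(1)] g(2)] by simp
  qed
  show ?thesis
  proof (rule char_unique_euclidean)
    fix t
    have i: "integrable (K z) (\<lambda>u. iexp (t \<bullet> u))" "integrable (L z) (\<lambda>u. iexp (t \<bullet> u))"
      using C(2)[OF K(1), of cos] C(2)[OF L(1), of cos] by auto
    have "(LINT u|K z. cos (t \<bullet> u)) = (LINT u|L z. cos (t \<bullet> u))"
      "(LINT u|K z. sin (t \<bullet> u)) = (LINT u|L z. sin (t \<bullet> u))"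
      by (auto intro!: U continuous_intros)
    then show "(CLINT u|K z. iexp (t \<bullet> u)) = (CLINT u|L z. iexp (t \<bullet> u))"
      using i by (simp add: complex_eq_iff Re_exp Im_exp flip: integral_Re integral_Im)
  qed (use P[OF K(1)] P[OF L(1)] in auto)
qed

text \<open>Only the shift \<open>h z\<close> depends on \<open>z\<close>, so dominated convergence
  with a constant bound gives sequential continuity, which suffices on a metric space.\<close>

lemma weakly_continuous_kernel_translate:
  fixes h :: "'y::metric_space \<Rightarrow> 'x::euclidean_space"
  assumes N: "prob_space N" and g [measurable]: "g \<in> borel_measurable N"
    and h: "continuous_on UNIV h"
  shows "weakly_continuous_kernel (\<lambda>z. distr N borel (\<lambda>v. h z + g v))"
  unfolding weakly_continuous_kernel_def
proof (intro allI impI)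
  fix f :: "'x \<Rightarrow> real" assume f: "continuous_on UNIV f" "bounded (range f)"
  interpret prob_space N by fact
  have [measurable]: "f \<in> borel_measurable borel"
    using f(1) by (rule borel_measurable_continuous_onI)
  obtain c where c: "\<And>u. norm (f u) \<le> c"
    using f(2) by (auto simp: bounded_iff)
  show "continuous_on UNIV (\<lambda>z. LINT u|distr N borel (\<lambda>v. h z + g v). f u)"
    unfolding continuous_on_sequentially
  proof safe
    fix w :: "nat \<Rightarrow> 'y" and z assume w: "w \<longlonglongrightarrow> z"
    have "(\<lambda>n. LINT v|N. f (h (w n) + g v)) \<longlonglongrightarrow> (LINT v|N. f (h z + g v))"
    proof (rule integral_dominated_convergence[where w = "\<lambda>_. c"])
      have "(\<lambda>n. f (h (w n) + g v)) \<longlonglongrightarrow> f (h z + g v)" for v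
        using w f(1) h by (intro continuous_on_tendsto_compose[OF f(1)] tendsto_intros
            continuous_on_tendsto_compose[OF h]) auto
      then show "AE v in N. (\<lambda>n. f (h (w n) + g v)) \<longlonglongrightarrow> f (h z + g v)" by simp
    qed (use c in auto)
    then show "((\<lambda>z. LINT u|distr N borel (\<lambda>v. h z + g v). f u) \<circ> w) \<longlonglongrightarrow>
        (LINT u|distr N borel (\<lambda>v. h z + g v). f u)"
      by (simp add: comp_def integral_distr)
  qed
qed

section \<open>Conditioning on a linear image\<close>

text \<open>By \<open>dec\<close>, \<open>x\<close> may be replaced in law by
  \<open>(R ** H) *v u + D *v v\<close> with independent \<open>u\<close> and \<open>v\<close>. Its
  image under \<open>H\<close> depends on \<open>u\<close> only, so fixing \<open>H *v u = z\<close>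
  leaves \<open>R *v z + D *v v\<close> with \<open>v\<close> still free.\<close>

lemma regular_cond_dist_decompose:
  fixes H :: "real^'n^'m" and R :: "real^'m^'n" and x :: "'w \<Rightarrow> real^'n"
  defines "D \<equiv> mat 1 - R ** H"
  assumes M: "prob_space M" and x [measurable]: "x \<in> borel_measurable M"
    and HR: "H ** R = mat 1"
    and dec: "distr (distr M borel x \<Otimes>\<^sub>M distr M borel x) borel (\<lambda>(u, v). (R ** H) *v u + D *v v) = distr M borel x"
  shows "regular_cond_dist M x (\<lambda>\<omega>. H *v x \<omega>) (\<lambda>z. distr (distr M borel x) borel (\<lambda>v. R *v z + D *v v))"
  unfolding regular_cond_dist_def
proof (intro conjI ballI)
  define \<mu> where "\<mu> = distr M borel x"
  have s\<mu> [measurable_cong]: "sets \<mu> = sets borel" by (simp add: \<mu>_def)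
  interpret prob_space M by fact
  interpret \<mu>: prob_space \<mu> unfolding \<mu>_def by (rule prob_space_distr) measurable
  have "\<mu> \<in> space (prob_algebra borel)"
    by (simp add: space_prob_algebra s\<mu> \<mu>.prob_space_axioms)
  then show K: "(\<lambda>z. distr (distr M borel x) borel (\<lambda>v. R *v z + D *v v)) \<in> borel \<rightarrow>\<^sub>M prob_algebra borel"
    unfolding \<mu>_def[symmetric]
    by (intro measurable_distr_prob_space2[where M = borel]) (auto intro: measurable_const)
  fix B :: "(real^'m) set" and C :: "(real^'n) set"
  assume [measurable]: "B \<in> sets borel" "C \<in> sets borel"
  have [measurable]: "(\<lambda>z. emeasure (distr \<mu> borel (\<lambda>v. R *v z + D *v v)) C) \<in> borel_measurable borel"
    using K by (intro measurable_emeasure_kernel[OF measurable_prob_algebraD]) (auto simp: \<mu>_def)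
  define E where "E = {u. H *v u \<in> B \<and> u \<in> C}"
  have E [measurable]: "E \<in> sets borel"
  proof -
    have "E = {u \<in> space borel. H *v u \<in> B} \<inter> C" by (auto simp: E_def)
    also have "\<dots> \<in> sets borel" by measurable
    finally show ?thesis .
  qed
  \<comment> \<open>\<open>H ** R = mat 1\<close> makes \<open>H\<close> annihilate the range of
    \<open>D\<close>.\<close>
  have HD: "H *v ((R ** H) *v u + D *v v) = H *v u" for u v
  proof -
    have "H *v (R *v w) = w" for w
      using HR by (simp add: matrix_vector_mul_assoc)
    then show ?thesis
      by (simp add: D_def matrix_vector_right_distrib matrix_vector_mult_diff_rdistrib
          matrix_vector_mult_diff_distrib flip: matrix_vector_mul_assoc)
  qed
  have "emeasure M {\<omega> \<in> space M. H *v x \<omega> \<in> B \<and> x \<omega> \<in> C} = emeasure \<mu> E"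
    unfolding \<mu>_def by (subst emeasure_distr) (auto simp: E_def intro!: arg_cong[where f = "emeasure M"])
  also have "\<dots> = emeasure (distr (\<mu> \<Otimes>\<^sub>M \<mu>) borel (\<lambda>(u, v). (R ** H) *v u + D *v v)) E"
    using dec by (simp add: \<mu>_def)
  also have "\<dots> = (\<integral>\<^sup>+ u. emeasure \<mu> (Pair u -` ((\<lambda>(u, v). (R ** H) *v u + D *v v) -` E \<inter> space (\<mu> \<Otimes>\<^sub>M \<mu>))) \<partial>\<mu>)"
  proof (subst emeasure_distr)
    show [measurable]: "(\<lambda>(u, v). (R ** H) *v u + D *v v) \<in> borel_measurable (\<mu> \<Otimes>\<^sub>M \<mu>)"
      by measurable
    show "emeasure (\<mu> \<Otimes>\<^sub>M \<mu>) ((\<lambda>(u, v). (R ** H) *v u + D *v v) -` E \<inter> space (\<mu> \<Otimes>\<^sub>M \<mu>)) =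
      (\<integral>\<^sup>+ u. emeasure \<mu> (Pair u -` ((\<lambda>(u, v). (R ** H) *v u + D *v v) -` E \<inter> space (\<mu> \<Otimes>\<^sub>M \<mu>))) \<partial>\<mu>)"
      by (intro \<mu>.emeasure_pair_measure_alt measurable_sets[where A = borel] E) measurable
  qed (rule E)
  \<comment> \<open>For fixed \<open>u\<close> the section is empty unless \<open>H *v u\<close>
    lies in \<open>B\<close>; otherwise only the condition on \<open>C\<close> remains, which is the
    kernel at \<open>H *v u\<close>.\<close>
  also have "\<dots> = (\<integral>\<^sup>+ u. emeasure (distr \<mu> borel (\<lambda>v. R *v (H *v u) + D *v v)) C * indicator B (H *v u) \<partial>\<mu>)"
  proof (rule nn_integral_cong)
    fix u
    have "space \<mu> = UNIV" by (simp add: \<mu>_def)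
    then have "Pair u -` ((\<lambda>(u, v). (R ** H) *v u + D *v v) -` E \<inter> space (\<mu> \<Otimes>\<^sub>M \<mu>)) =
        (if H *v u \<in> B then (\<lambda>v. R *v (H *v u) + D *v v) -` C \<inter> space \<mu> else {})"
      by (auto simp: E_def HD space_pair_measure matrix_vector_mul_assoc)
    then show "emeasure \<mu> (Pair u -` ((\<lambda>(u, v). (R ** H) *v u + D *v v) -` E \<inter> space (\<mu> \<Otimes>\<^sub>M \<mu>))) =
        emeasure (distr \<mu> borel (\<lambda>v. R *v (H *v u) + D *v v)) C * indicator B (H *v u)"
      by (simp add: emeasure_distr)
  qed
  also have "\<dots> = (\<integral>\<^sup>+ \<omega>. emeasure (distr \<mu> borel (\<lambda>v. R *v (H *v x \<omega>) + D *v v)) C * indicator B (H *v x \<omega>) \<partial>M)"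
  proof -
    have "(\<integral>\<^sup>+ u. g u \<partial>\<mu>) = (\<integral>\<^sup>+ \<omega>. g (x \<omega>) \<partial>M)" if "g \<in> borel_measurable borel" for g
      unfolding \<mu>_def using that by (intro nn_integral_distr) auto
    then show ?thesis by this measurable
  qed
  also have "\<dots> = (\<integral>\<^sup>+ z \<in> B. emeasure (distr \<mu> borel (\<lambda>v. R *v z + D *v v)) C \<partial>distr M borel (\<lambda>\<omega>. H *v x \<omega>))"
    by (subst nn_integral_distr) auto
  finally show "emeasure M {\<omega> \<in> space M. H *v x \<omega> \<in> B \<and> x \<omega> \<in> C} =
     (\<integral>\<^sup>+ z \<in> B. emeasure (distr (distr M borel x) borel (\<lambda>v. R *v z + D *v v)) C \<partial>distr M borel (\<lambda>\<omega>. H *v x \<omega>))"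
    unfolding \<mu>_def .
qed

section \<open>The conditional law of \<open>x\<close> given the observation\<close>

theorem theorem2:
  fixes A :: "real^'n^'n"
    and W V :: "real^'m^'n"
    and b x\<^sub>0 xt :: "real^'n"
    and Y :: "real^'p^'n"
    and G :: "real^'p^'p"
    and S\<^sub>0 :: "real^'n^'n"
    and M :: "'w measure"
    and x :: "'w \<Rightarrow> real^'n"
    and y :: "'w \<Rightarrow> real^'m"
  assumes "CARD('m) \<le> CARD('n)"
    and "invertible A"
    and "rank W = CARD('m)" and "rank V = CARD('m)"
    and "det (transpose W ** A ** V) \<noteq> 0"
    and "range ((*v) Y) = {v. (transpose W ** A) *v v = 0}"
    and "pos_semidef G"
    and "S\<^sub>0 = V ** transpose V + Y ** G ** transpose Y"
    and "prob_space M"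
    and "x \<in> borel_measurable M"
    and "gaussian_law x\<^sub>0 S\<^sub>0 (distr M borel x)"
    and "y = (\<lambda>\<omega>. (transpose W ** A) *v x \<omega>)"
    and "xt = x\<^sub>0 + (V ** matrix_inv (transpose W ** A ** V) ** transpose W) *v (b - A *v x\<^sub>0)"
  shows "\<exists>N. gaussian_law xt (Y ** G ** transpose Y) N \<and>
             cond_dist_at M x y (transpose W *v b) N"
proof -
  define H where "H = transpose W ** A"
  define R where "R = V ** matrix_inv (H ** V)"
  define D where "D = mat 1 - R ** H"
  define \<mu> where "\<mu> = distr M borel x"
  define K where "K z = distr \<mu> borel (\<lambda>v. R *v z + D *v v)" for z
  note x [measurable] = \<open>x \<in> borel_measurable M\<close>
  have y: "y = (\<lambda>\<omega>. H *v x \<omega>)" using assms(12) by (simp add: H_def)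
  have inv: "invertible (H ** V)"
    using assms(5) by (simp add: H_def invertible_det_nz)
  have HR: "H ** R = mat 1"
    using matrix_mul_matrix_inv[OF inv] by (simp add: R_def matrix_mul_assoc)
  have RHV: "R ** H ** V = V"
  proof -
    have "R ** H ** V = V ** (matrix_inv (H ** V) ** (H ** V))"
      by (simp add: R_def matrix_mul_assoc)
    then show ?thesis by (simp add: matrix_inv_matrix_mul[OF inv])
  qed
  have HY: "H ** Y = 0"
    using assms(6) by (auto simp: H_def matrix_eq simp flip: matrix_vector_mul_assoc)
  \<comment> \<open>\<open>R ** H\<close> fixes the columns of \<open>V\<close> and kills those of
    \<open>Y\<close>; its complement \<open>D\<close> does the reverse.\<close>
  have DV: "D ** V = 0" and DY: "D ** Y = Y"
  proof -
    have "R *v (H *v (V *v w)) = V *v w" "H *v (Y *v u) = 0" for w u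
      using RHV HY by (simp_all add: matrix_vector_mul_assoc matrix_mul_assoc)
    then show "D ** V = 0" "D ** Y = Y"
      by (simp_all add: D_def matrix_eq matrix_vector_mult_diff_rdistrib flip: matrix_vector_mul_assoc)
  qed
  \<comment> \<open>Used for \<open>D\<close>, \<open>R ** H\<close> and \<open>H\<close>; in each
    case one of the two summands vanishes.\<close>
  have conj: "B ** S\<^sub>0 ** transpose B = (B ** V) ** transpose (B ** V) + (B ** Y) ** G ** transpose (B ** Y)"
    for B :: "real^'n^'k"
    by (simp add: assms(8) matrix_add_ldistrib matrix_mul_add_rdistrib matrix_transpose_mul matrix_mul_assoc)
  have covD: "D ** S\<^sub>0 ** transpose D = Y ** G ** transpose Y"
    unfolding conj DV DY by simp
  have covR: "(R ** H) ** S\<^sub>0 ** transpose (R ** H) = V ** transpose V"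
    unfolding conj RHV by (simp add: HY flip: matrix_mul_assoc)
  have covH: "H ** S\<^sub>0 ** transpose H = (H ** V) ** transpose (H ** V)"
    unfolding conj HY by simp
  have law: "gaussian_law x\<^sub>0 S\<^sub>0 \<mu>" and p\<mu>: "prob_space \<mu>"
    using assms by (auto simp: \<mu>_def intro: prob_space.prob_space_distr)
  have dec: "distr (\<mu> \<Otimes>\<^sub>M \<mu>) borel (\<lambda>(u, v). (R ** H) *v u + D *v v) = \<mu>"
  proof (rule gaussian_law_decompose[OF law p\<mu>])
    show "R ** H + D = mat 1" by (simp add: D_def)
    show "R ** H ** S\<^sub>0 ** transpose (R ** H) + D ** S\<^sub>0 ** transpose D = S\<^sub>0"
      unfolding covD covR by (simp add: assms(8))
  qed
  have reg: "regular_cond_dist M x y K"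
    unfolding y K_def D_def \<mu>_def
    by (rule regular_cond_dist_decompose[OF assms(9) x HR dec[unfolded \<mu>_def D_def]])
  have [measurable_cong]: "sets \<mu> = sets borel" by (simp add: \<mu>_def)
  have wc: "weakly_continuous_kernel K"
    unfolding K_def by (intro weakly_continuous_kernel_translate p\<mu> continuous_intros) measurable
  \<comment> \<open>The covariance of \<open>y\<close> has the form needed for full support, with
    the invertible square factor \<open>H ** V\<close>.\<close>
  have ylaw: "gaussian_law (H *v x\<^sub>0) ((H ** V) ** transpose (H ** V)) (distr M borel y)"
    using gaussian_law_affine[OF law p\<mu>, of 0 H] by (simp add: covH y \<mu>_def distr_distr comp_def)
  have ym: "y \<in> borel_measurable M" unfolding y by measurable
  have uniq: "L z = K z" if "regular_cond_dist M x y L" "weakly_continuous_kernel L" for L z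
    using weakly_continuous_cond_dist_unique[OF assms(9) x ym that reg wc]
      gaussian_law_open_nonnull[OF ylaw prob_space.prob_space_distr[OF assms(9) ym] inv] by blast
  \<comment> \<open>The mean of the kernel at \<open>transpose W *v b\<close>; its covariance
    \<open>D ** S\<^sub>0 ** transpose D\<close> is the same at every point.\<close>
  have "R *v (transpose W *v b) + D *v x\<^sub>0 = xt"
    by (simp add: assms(13) D_def R_def H_def matrix_vector_mult_diff_rdistrib
        matrix_vector_mult_diff_distrib matrix_mul_assoc matrix_vector_mul_assoc
        del: transpose_matrix_vector)
  then have "gaussian_law xt (Y ** G ** transpose Y) (K (transpose W *v b))"
    using gaussian_law_affine[OF law p\<mu>, of "R *v (transpose W *v b)" D] by (simp add: covD K_def)
  moreover have "cond_dist_at M x y (transpose W *v b) (K (transpose W *v b))"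
    unfolding cond_dist_at_def using reg wc uniq by blast
  ultimately show ?thesis by blast
qed

end
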